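(* Let $(\Omega,\mathcal{F},\mathfrak{F},\mathsf{R})$ be a complete right-continuous filtered space, where $\Omega=D(\mathbb{R}^+;\varGamma)$ and $\mathsf{R}\in\mathcal{P}(\Omega)$ is the reference path measure of the jump process with bounded transition rate $L$, and let $\tau$ be an $\mathfrak{F}$-stopping time. Let $f:\varGamma\to[0,+\infty]$ be a proper $\sigma(X_\tau)$-measurable terminal cost for which there exists a $\sigma(X_\tau)$-measurable set $D\subset \mathrm{dom}\,f$ with $$\mathsf{R}_\tau(D)>0\qquad\text{and}\qquad \int_D f\,\mathrm{d}\mathsf{R}_\tau<+\infty .$$ Then, for any $\mu\in\mathcal{P}(\varGamma)$ with $\mathsf{Ent}(\mu\,|\,\mathsf{R}_0)<+\infty$, the stochastic optimal control problem $$\gamma_{\rm sto}(\mu)=\inf\left\{\mathsf{E}_{\mathsf{Q}}\Bigl[f(X_\tau)+\log\frac{\mathrm{d}\mathsf{Q}}{\mathrm{d}\mathsf{R}}\Bigr]\;:\;\mathsf{Q}\in\mathcal{P}(\Omega),\ \mathsf{Q}_0=\mu\right\}$$ admits a minimizer.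
   Context: Setting. $\varGamma$ is a Polish space, $\mathbb{R}^+=[0,+\infty)$, and $\Omega=D(\mathbb{R}^+;\varGamma)$ is the Skorokhod space of càdlàg paths, with canonical process $X_t(\omega)=\omega_t$. $\mathcal{F}^X=\sigma(X_t:t\ge0)$, and $\mathfrak{F}^X_+$ is the right-continuous extension of the canonical filtration $\{\sigma(X_s:s\le t)\}_{t\ge0}$; $\mathcal{F}$ and $\mathfrak{F}$ are the $\mathsf{R}$-completions of $\mathcal{F}^X$ and $\mathfrak{F}^X_+$. Reference measure. $\{L(x,\cdot)\}_{x\in\varGamma}$ is a Borel family of nonnegative measures on $\varGamma$ with $\sup_{x}\int_\varGamma L(x,\mathrm{d}y)<+\infty$. $\mathsf{R}\in\mathcal{P}(\Omega)$ is the law (with initial law $\mathsf{R}_0$) of the time-homogeneous Markov jump process with transition rate $L$, i.e. for every bounded Borel $\varphi$ on $\mathbb{R}^+\times\varGamma\times\varGamma$ the process $\sum_{s\le t,\,X_s\ne X_{s^-}}\varphi_s(X_{s^-},X_s)-\int_0^t\int_\varGamma\varphi_s(X_{s^-},y)L(X_{s^-},\mathrm{d}y)\,\mathrm{d}s$ is an $\mathsf{R}$-martingale. It is assumed that $X$ under $\mathsf{R}$ is positive in the sense of Meyn–Tweedie (so that there is a unique invariant probability measure $\pi$). Notation. For $\mathsf{Q}\in\mathcal{P}(\Omega)$, $\mathsf{Q}_0=(X_0)_\#\mathsf{Q}$ and $\mathsf{Q}_\tau=(X_\tau)_\#\mathsf{Q}$. $\mathsf{E}_{\mathsf{Q}}$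 is expectation under $\mathsf{Q}$. The relative entropy is $\mathsf{Ent}(\alpha|\beta)=\int \phi(\mathrm{d}\alpha/\mathrm{d}\beta)\,\mathrm{d}\beta$ with $\phi(s)=s\log s-s+1$ if $\alpha\ll\beta$, and $+\infty$ otherwise; for probability measures it equals $\mathsf{E}_\alpha[\log(\mathrm{d}\alpha/\mathrm{d}\beta)]$, and the cost is $+\infty$ when $\mathsf{Q}\not\ll\mathsf{R}$. $f$ is proper if it is not identically $+\infty$; $\mathrm{dom}\,f=\{x\in\varGamma:f(x)<+\infty\}$. $\sigma(X_\tau)$-measurability of $f$ (resp. $D$) means that $f(X_\tau)$ (resp. $\{X_\tau\in D\}$) is $\sigma(X_\tau)$-measurable. *)

theory Defs
  imports "HOL-Probability.Probability"
begin

section \<open>Skorokhod path space\<close>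

text \<open>Paths are functions on \<open>real\<close> that are \<open>undefined\<close> at negative times, so that two paths are
  equal iff they agree on the nonnegative half-line.\<close>

definition cadlag_paths :: "(real \<Rightarrow> 'a::polish_space) set" where
  "cadlag_paths = {\<omega> \<in> extensional {0..}.
     (\<forall>t\<ge>0. (\<omega> \<longlongrightarrow> \<omega> t) (at_right t)) \<and> (\<forall>t>0. \<exists>l. (\<omega> \<longlongrightarrow> l) (at_left t))}"

definition coord_sigma :: "real set \<Rightarrow> (real \<Rightarrow> 'a::polish_space) measure" where
  "coord_sigma T = sigma cadlag_paths
     {{\<omega> \<in> cadlag_paths. \<omega> s \<in> A} | s A. s \<in> T \<and> A \<in> sets borel}"

text \<open>The sigma-algebra generated by all coordinates; it is the Borel sigma-algebra of the
  Skorokhod topology, so path measures are the probability measures on it.\<close>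

definition path_space :: "(real \<Rightarrow> 'a::polish_space) measure" where
  "path_space = coord_sigma {0..}"

definition path_measure :: "(real \<Rightarrow> 'a::polish_space) measure \<Rightarrow> bool" where
  "path_measure Q \<longleftrightarrow> prob_space Q \<and> sets Q = sets path_space"

definition marginal :: "(real \<Rightarrow> 'a::polish_space) measure \<Rightarrow> real \<Rightarrow> 'a measure" where
  "marginal Q t = distr Q borel (\<lambda>\<omega>. \<omega> t)"

definition right_filtration :: "real \<Rightarrow> (real \<Rightarrow> 'a::polish_space) measure" where
  "right_filtration t = sigma cadlag_paths (\<Inter>u\<in>{t<..}. sets (coord_sigma {0..u}))"

text \<open>The completed right-continuous filtration. Its index set is \<^typ>\<open>ennreal\<close>, with the whole
  completed sigma-algebra at time infinity, so that the library's \<^const>\<open>stopping_time\<close> speaks about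
  times with values in \<open>[0, \<infinity>]\<close>.\<close>

definition aug_filtration ::
    "(real \<Rightarrow> 'a::polish_space) measure \<Rightarrow> ennreal \<Rightarrow> (real \<Rightarrow> 'a) measure" where
  "aug_filtration R t =
     (if t = \<top> then completion R
      else sigma cadlag_paths
             (sets (right_filtration (enn2real t)) \<union> null_sets (completion R)))"

section \<open>Markov jump processes\<close>

definition bounded_rate :: "('a::polish_space \<Rightarrow> 'a measure) \<Rightarrow> bool" where
  "bounded_rate L \<longleftrightarrow>
     (\<forall>x. sets (L x) = sets borel) \<and>
     (\<forall>A\<in>sets borel. (\<lambda>x. emeasure (L x) A) \<in> borel_measurable borel) \<and>
     (SUP x. emeasure (L x) UNIV) < \<top>"

definition left_lim :: "(real \<Rightarrow> 'a::polish_space) \<Rightarrow> real \<Rightarrow> 'a" where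
  "left_lim \<omega> s = (if s > 0 then Lim (at_left s) \<omega> else \<omega> 0)"

text \<open>Equivalently, by compactness: on every bounded time interval there are finitely many jumps
  and the path is constant between them.\<close>

definition pure_jump_path :: "(real \<Rightarrow> 'a::polish_space) \<Rightarrow> bool" where
  "pure_jump_path \<omega> \<longleftrightarrow>
     (\<forall>t\<ge>0. \<forall>\<^sub>F s in at_right t. \<omega> s = \<omega> t) \<and>
     (\<forall>t>0. \<exists>x. \<forall>\<^sub>F s in at_left t. \<omega> s = x)"

definition martingale_process ::
    "'w measure \<Rightarrow> (ennreal \<Rightarrow> 'w measure) \<Rightarrow> (real \<Rightarrow> 'w \<Rightarrow> real) \<Rightarrow> bool" where
  "martingale_process M F Y \<longleftrightarrow>
     (\<forall>t\<ge>0. Y t \<in> borel_measurable (F (ennreal t)) \<and> integrable M (Y t)) \<and>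
     (\<forall>s t. 0 \<le> s \<and> s \<le> t \<longrightarrow> (AE \<omega> in M. real_cond_exp M (F (ennreal s)) (Y t) \<omega> = Y s \<omega>))"

definition compensated_jumps ::
    "('a::polish_space \<Rightarrow> 'a measure) \<Rightarrow> (real \<times> 'a \<times> 'a \<Rightarrow> real) \<Rightarrow> real \<Rightarrow> (real \<Rightarrow> 'a) \<Rightarrow> real" where
  "compensated_jumps L \<phi> t \<omega> =
     (\<Sum>s\<in>{s \<in> {0<..t}. \<omega> s \<noteq> left_lim \<omega> s}. \<phi> (s, left_lim \<omega> s, \<omega> s))
     - (LINT s:{0..t}|lborel. (LINT y|L (left_lim \<omega> s). \<phi> (s, left_lim \<omega> s, y)))"

text \<open>The first clause on paths expresses that this is a jump process: it makes the jump sums above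
  finite almost surely, and it excludes continuous motion between jumps, which the martingale
  property alone does not see.\<close>

definition jump_law ::
    "('a::polish_space \<Rightarrow> 'a measure) \<Rightarrow> (real \<Rightarrow> 'a) measure \<Rightarrow> bool" where
  "jump_law L R \<longleftrightarrow>
     path_measure R \<and>
     (AE \<omega> in R. pure_jump_path \<omega>) \<and>
     (\<forall>\<phi>. \<phi> \<in> borel_measurable borel \<and> (\<exists>C. \<forall>z. \<bar>\<phi> z\<bar> \<le> C) \<longrightarrow>
        martingale_process (completion R) (aug_filtration R) (compensated_jumps L \<phi>))"

text \<open>Meyn--Tweedie: a process is \<open>\<psi>\<close>-irreducible if sets of positive \<open>\<psi>\<close>-measure have positive
  expected occupation time from every starting point, and positive if it is moreover equipped with
  an invariant probability measure. \<open>P x\<close> is the law of the process started at \<open>x\<close>.\<close>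

definition jump_family ::
    "('a::polish_space \<Rightarrow> 'a measure) \<Rightarrow> ('a \<Rightarrow> (real \<Rightarrow> 'a) measure) \<Rightarrow> bool" where
  "jump_family L P \<longleftrightarrow>
     P \<in> borel \<rightarrow>\<^sub>M prob_algebra path_space \<and>
     (\<forall>x. jump_law L (P x) \<and> marginal (P x) 0 = return borel x)"

definition irreducible_family :: "('a::polish_space \<Rightarrow> (real \<Rightarrow> 'a) measure) \<Rightarrow> bool" where
  "irreducible_family P \<longleftrightarrow>
     (\<exists>\<psi>. sets \<psi> = sets borel \<and> sigma_finite_measure \<psi> \<and> emeasure \<psi> UNIV > 0 \<and>
        (\<forall>B\<in>sets borel. emeasure \<psi> B > 0 \<longrightarrow>
           (\<forall>x. (\<integral>\<^sup>+\<omega>. (\<integral>\<^sup>+t\<in>{0..}. indicator B (\<omega> t) \<partial>lborel) \<partial>P x) > 0)))"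

definition invariant_prob ::
    "('a::polish_space \<Rightarrow> (real \<Rightarrow> 'a) measure) \<Rightarrow> 'a measure \<Rightarrow> bool" where
  "invariant_prob P \<pi> \<longleftrightarrow>
     prob_space \<pi> \<and> sets \<pi> = sets borel \<and>
     (\<forall>t\<ge>0. \<forall>B\<in>sets borel. (\<integral>\<^sup>+x. emeasure (marginal (P x) t) B \<partial>\<pi>) = emeasure \<pi> B)"

definition positive_jump_process :: "('a::polish_space \<Rightarrow> 'a measure) \<Rightarrow> bool" where
  "positive_jump_process L \<longleftrightarrow>
     (\<exists>P. jump_family L P \<and> irreducible_family P \<and> (\<exists>\<pi>. invariant_prob P \<pi>))"

section \<open>The state at a stopping time\<close>

text \<open>\<open>\<xi>\<close> gives the state on the event that the stopping time is infinite; it is irrelevant, up to a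
  null set, if the stopping time is almost surely finite.\<close>

definition state_at ::
    "((real \<Rightarrow> 'a) \<Rightarrow> ennreal) \<Rightarrow> ((real \<Rightarrow> 'a) \<Rightarrow> 'a) \<Rightarrow> (real \<Rightarrow> 'a) \<Rightarrow> 'a" where
  "state_at \<tau> \<xi> \<omega> = (if \<tau> \<omega> = \<top> then \<xi> \<omega> else \<omega> (enn2real (\<tau> \<omega>)))"

text \<open>The push-forward, on the largest sigma-algebra that makes \<open>g\<close> measurable. It extends the law on
  the Borel sets, and it can measure any \<open>D\<close> for which \<open>{g \<in> D}\<close> belongs to \<open>\<sigma>(g)\<close>, even if \<open>D\<close> is
  not Borel outside the range of \<open>g\<close>.\<close>

definition image_law :: "'w measure \<Rightarrow> ('w \<Rightarrow> 'a) \<Rightarrow> 'a measure" where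
  "image_law M g = distr M (sigma UNIV {B. g -` B \<inter> space M \<in> sets M}) g"

section \<open>Relative entropy and the control problem\<close>

definition rel_entropy :: "'b measure \<Rightarrow> 'b measure \<Rightarrow> ennreal" where
  "rel_entropy \<alpha> \<beta> =
     (if absolutely_continuous \<beta> \<alpha>
      then (\<integral>\<^sup>+x. (let s = enn2real (RN_deriv \<beta> \<alpha> x) in ennreal (s * ln s - s + 1)) \<partial>\<beta>)
      else \<top>)"

text \<open>\<^const>\<open>e2ennreal\<close> sends negative numbers to 0, so this is the integral of the positive part
  minus the integral of the negative part. In the cost below the latter is finite.\<close>

definition ext_expectation :: "'w measure \<Rightarrow> ('w \<Rightarrow> ereal) \<Rightarrow> ereal" where
  "ext_expectation M g =
     enn2ereal (\<integral>\<^sup>+\<omega>. e2ennreal (g \<omega>) \<partial>M) - enn2ereal (\<integral>\<^sup>+\<omega>. e2ennreal (- g \<omega>) \<partial>M)"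

text \<open>The expectation is under the completion of \<open>Q\<close>, since the terminal cost is only measurable with
  respect to the \<open>R\<close>-completion (which the \<open>Q\<close>-completion contains if \<open>Q\<close> is absolutely continuous
  with respect to \<open>R\<close>). The derivative is \<open>Q\<close>-almost surely positive and finite.\<close>

definition control_cost ::
    "(real \<Rightarrow> 'a::polish_space) measure \<Rightarrow> ((real \<Rightarrow> 'a) \<Rightarrow> 'a) \<Rightarrow> ('a \<Rightarrow> ennreal)
      \<Rightarrow> (real \<Rightarrow> 'a) measure \<Rightarrow> ereal" where
  "control_cost R X\<tau> f Q =
     (if absolutely_continuous R Q
      then ext_expectation (completion Q)
             (\<lambda>\<omega>. enn2ereal (f (X\<tau> \<omega>)) + ereal (ln (enn2real (RN_deriv R Q \<omega>))))
      else \<infinity>)"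

definition admissible :: "'a::polish_space measure \<Rightarrow> (real \<Rightarrow> 'a) measure set" where
  "admissible \<mu> = {Q. path_measure Q \<and> marginal Q 0 = \<mu>}"

definition gamma_sto ::
    "(real \<Rightarrow> 'a::polish_space) measure \<Rightarrow> ((real \<Rightarrow> 'a) \<Rightarrow> 'a) \<Rightarrow> ('a \<Rightarrow> ennreal)
      \<Rightarrow> 'a measure \<Rightarrow> ereal" where
  "gamma_sto R X\<tau> f \<mu> = (INF Q\<in>admissible \<mu>. control_cost R X\<tau> f Q)"

end

theory Submission
  imports Defs
begin

text \<open>Write \<open>F = f(X\<^sub>\<tau>)\<close>, and let \<open>P = exp(-F) R\<close> be the tilted path measure, of mass at most 1. For
  every \<open>Q\<close> absolutely continuous with respect to \<open>R\<close> with \<open>F < \<infinity>\<close> \<open>Q\<close>-almost surely, the chain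
  rule gives \<open>dQ/dR = (dQ/dP) exp(-F)\<close>, so the cost of \<open>Q\<close> is just the relative entropy
  \<open>E\<^sub>Q[log dQ/dP]\<close> of \<open>Q\<close> with respect to \<open>P\<close>; all other \<open>Q\<close> have infinite cost
  (\<open>control_cost_eq_entropy\<close>). The problem thus is to minimise an entropy under the constraint that
  the initial law is \<open>\<mu>\<close>, and this can be solved explicitly, without any compactness argument.

  Let \<open>\<nu>\<close> be the initial law of \<open>P\<close>. Relative entropy does not increase under push-forwards
  (\<open>entropy_push_forward_le\<close>), so every admissible \<open>Q\<close> costs at least the entropy of \<open>\<mu>\<close> with
  respect to \<open>\<nu>\<close>. If \<open>\<mu>\<close> is absolutely continuous with respect to \<open>\<nu>\<close>, this bound is attained by
  the path measure with \<open>P\<close>-density \<open>d\<mu>/d\<nu>(X\<^sub>0)\<close>, which has the initial law \<open>\<mu>\<close>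
  (\<open>entropy_lift_marginal\<close>). Otherwise no admissible \<open>Q\<close> is absolutely continuous with respect to
  \<open>P\<close>, so the cost is identically infinite and each admissible path measure is a minimiser; one of
  them has the \<open>R\<close>-density \<open>d\<mu>/dR\<^sub>0(X\<^sub>0)\<close>, which exists because \<open>\<mu>\<close> has finite entropy with
  respect to \<open>R\<^sub>0\<close>.

  The remaining work is to show that \<open>X\<^sub>\<tau>\<close> is measurable for the completed sigma-algebra, which
  follows from the right-continuity of paths by discretising \<open>\<tau>\<close> from above.\<close>

section \<open>Relative entropy with respect to a finite measure\<close>

text \<open>The reference measure need not have mass 1, so the value may be negative. Positive and negative
  part are integrated separately because the positive part may have infinite integral.\<close>

definition signed_entropy :: "'b measure \<Rightarrow> 'b measure \<Rightarrow> ereal" where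
  "signed_entropy P Q = ext_expectation Q (\<lambda>x. ereal (ln (enn2real (RN_deriv P Q x))))"

lemma ext_expectation_cong_AE:
  assumes "AE x in M. g x = h x"
  shows "ext_expectation M g = ext_expectation M h"
proof -
  have "(\<integral>\<^sup>+x. e2ennreal (g x) \<partial>M) = (\<integral>\<^sup>+x. e2ennreal (h x) \<partial>M)"
    "(\<integral>\<^sup>+x. e2ennreal (- g x) \<partial>M) = (\<integral>\<^sup>+x. e2ennreal (- h x) \<partial>M)"
    using assms by (auto intro!: nn_integral_cong_AE)
  then show ?thesis
    by (simp add: ext_expectation_def)
qed

lemma AE_RN_deriv_pos_finite:
  assumes "sigma_finite_measure P" "sigma_finite_measure Q"
    and ac: "absolutely_continuous P Q" and sets: "sets Q = sets P"
  shows "AE x in Q. 0 < RN_deriv P Q x \<and> RN_deriv P Q x < \<top>"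
proof -
  interpret P: sigma_finite_measure P by fact
  have "AE x in density P (RN_deriv P Q). 0 < RN_deriv P Q x"
    by (subst AE_density) auto
  then have "AE x in Q. 0 < RN_deriv P Q x"
    by (simp only: P.density_RN_deriv[OF ac sets])
  moreover have "AE x in Q. RN_deriv P Q x \<noteq> \<infinity>"
    using P.RN_deriv_finite[OF assms(2) ac sets]
    by (rule absolutely_continuous_AE[OF sets ac])
  ultimately show ?thesis
    by eventually_elim (auto simp: less_top)
qed

text \<open>Since \<open>z log(1/z) \<le> 1 - z\<close>, the integrand is at most 1 after the change to the reference
  measure. For a finite reference measure, the difference of integrals in the entropy is therefore
  never \<open>\<infinity> - \<infinity>\<close>.\<close>

lemma nn_integral_neg_log_RN_deriv_le:
  assumes "sigma_finite_measure P" "sigma_finite_measure Q"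
    and ac: "absolutely_continuous P Q" and sets: "sets Q = sets P"
  shows "(\<integral>\<^sup>+x. ennreal (- ln (enn2real (RN_deriv P Q x))) \<partial>Q) \<le> emeasure P (space P)"
proof -
  interpret P: sigma_finite_measure P by fact
  have bound: "z * ennreal (- ln (enn2real z)) \<le> 1" if "z \<noteq> \<infinity>" for z :: ennreal
  proof (cases z)
    case (real r)
    show ?thesis
    proof (cases "r > 0")
      case True
      have "- ln r \<le> 1 / r - 1"
        using ln_le_minus_one[of "1 / r"] True by (simp add: ln_div)
      then have "r * (- ln r) \<le> r * (1 / r - 1)"
        using True by (intro mult_left_mono) auto
      also have "\<dots> \<le> 1"
        using True by (simp add: field_simps)
      finally show ?thesis
        using real True by (simp add: ennreal_mult'[symmetric])
    qed (use real in auto)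
  qed (use that in auto)
  have "(\<integral>\<^sup>+x. ennreal (- ln (enn2real (RN_deriv P Q x))) \<partial>Q)
      = (\<integral>\<^sup>+x. RN_deriv P Q x * ennreal (- ln (enn2real (RN_deriv P Q x))) \<partial>P)"
    by (intro P.RN_deriv_nn_integral[OF ac sets]) measurable
  also have "\<dots> \<le> (\<integral>\<^sup>+x. 1 \<partial>P)"
    using P.RN_deriv_finite[OF assms(2) ac sets]
    by (intro nn_integral_mono_AE) (auto elim!: eventually_mono intro: bound)
  finally show ?thesis
    by simp
qed

text \<open>The inequality \<open>log x \<le> x - 1\<close> at \<open>x = s/z\<close>, with the logarithms split into positive and
  negative parts and rearranged so that every summand is nonnegative and can be integrated.\<close>

lemma log_ratio_bound_ennreal:
  fixes s z :: real
  assumes "0 < s" "0 < z"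
  shows "ennreal (ln s) + 1 + ennreal (- ln z)
    \<le> ennreal (ln z) + ennreal s / ennreal z + ennreal (- ln s)"
proof -
  have "ln s - ln z \<le> s / z - 1"
    using ln_le_minus_one[of "s / z"] assms by (simp add: ln_div)
  then have le: "max 0 (ln s) + 1 + max 0 (- ln z) \<le> max 0 (ln z) + s / z + max 0 (- ln s)"
    by linarith
  have "ennreal (ln s) + 1 + ennreal (- ln z) = ennreal (max 0 (ln s) + 1 + max 0 (- ln z))"
    by (simp add: ennreal_plus max_def ennreal_neg)
  also have "\<dots> \<le> ennreal (max 0 (ln z) + s / z + max 0 (- ln s))"
    using le by (rule ennreal_leI)
  also have "\<dots> = ennreal (ln z) + ennreal s / ennreal z + ennreal (- ln s)"
    using assms by (simp add: ennreal_plus divide_ennreal max_def ennreal_neg)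
  finally show ?thesis .
qed

lemma ereal_diff_le_of_cross_sum:
  fixes a b c d w :: ennreal
  assumes "a + 1 + d \<le> c + w + b" "w \<le> 1" "b < \<top>" "d < \<top>"
  shows "enn2ereal a - enn2ereal b \<le> enn2ereal c - enn2ereal d"
proof -
  have le: "a + 1 + d \<le> c + 1 + b"
    using assms(1) by (rule order_trans) (intro add_mono order_refl assms(2))
  obtain rb where b: "b = ennreal rb" "0 \<le> rb"
    using assms(3) by (cases b) auto
  obtain rd where d: "d = ennreal rd" "0 \<le> rd"
    using assms(4) by (cases d) auto
  show ?thesis
  proof (cases c)
    case (real rc)
    have "a \<noteq> \<top>"
      using le unfolding real b d by (auto simp: top_unique)
    then obtain ra where a: "a = ennreal ra" "0 \<le> ra"
      by (cases a) auto
    have "ennreal (ra + 1 + rd) \<le> ennreal (rc + 1 + rb)"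
      using le a b d real by (simp add: ennreal_plus)
    then have "ra + 1 + rd \<le> rc + 1 + rb"
      using real b by (subst (asm) ennreal_le_iff) auto
    then show ?thesis
      using a b d real by (simp add: enn2ereal_ennreal)
  next
    case top
    then show ?thesis
      using d by (simp add: enn2ereal_ennreal)
  qed
qed

section \<open>Entropy and push-forwards\<close>

lemma absolutely_continuous_distr:
  assumes ac: "absolutely_continuous P Q" and sets: "sets Q = sets P" and T: "T \<in> P \<rightarrow>\<^sub>M S"
  shows "absolutely_continuous (distr P S T) (distr Q S T)"
proof -
  have TQ: "T \<in> Q \<rightarrow>\<^sub>M S"
    using T by (simp add: measurable_cong_sets[OF sets refl])
  have "emeasure (distr Q S T) A = 0" if "A \<in> sets S" "emeasure (distr P S T) A = 0" for A
  proof -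
    have "emeasure P (T -` A \<inter> space P) = 0"
      using that T by (simp add: emeasure_distr)
    then have "emeasure Q (T -` A \<inter> space P) = 0"
      using ac T that(1) by (intro absolutely_continuousD[OF ac]) (auto intro: measurable_sets)
    then show ?thesis
      using that TQ by (simp add: emeasure_distr sets_eq_imp_space_eq[OF sets])
  qed
  then show ?thesis
    by (auto simp: absolutely_continuous_def null_sets_def)
qed

text \<open>With \<open>s = d(T\<^sub>#Q)/d(T\<^sub>#P)\<close> and \<open>z = dQ/dP\<close>, the difference of the two entropies is
  \<open>E\<^sub>Q[log(s(T)/z)] \<le> E\<^sub>Q[s(T)/z] - 1\<close>, and \<open>E\<^sub>Q[s(T)/z]\<close> is at most the \<open>P\<close>-integral of \<open>s(T)\<close>, which
  is 1.\<close>

lemma entropy_push_forward_le: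
  assumes P: "finite_measure P" and Q: "prob_space Q"
    and ac: "absolutely_continuous P Q" and sets: "sets Q = sets P" and T: "T \<in> P \<rightarrow>\<^sub>M S"
  shows "signed_entropy (distr P S T) (distr Q S T) \<le> signed_entropy P Q"
proof -
  interpret P: finite_measure P by fact
  interpret Q: prob_space Q by fact
  have TQ[measurable]: "T \<in> Q \<rightarrow>\<^sub>M S"
    using T by (simp add: measurable_cong_sets[OF sets refl])
  note [measurable] = T
  define N where "N = distr P S T"
  define M where "M = distr Q S T"
  interpret N: finite_measure N
    unfolding N_def by (rule P.finite_measure_distr[OF T])
  interpret M: prob_space M
    unfolding M_def by (rule Q.prob_space_distr[OF TQ])
  have NM: "absolutely_continuous N M" "sets M = sets N"
    unfolding N_def M_def using absolutely_continuous_distr[OF ac sets T] by auto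
  define s where "s = RN_deriv N M"
  define z where "z = RN_deriv P Q"
  have s_N[measurable]: "s \<in> borel_measurable S"
    using borel_measurable_RN_deriv[of N M] unfolding s_def N_def by simp
  have z_P[measurable]: "z \<in> borel_measurable P"
    unfolding z_def by simp
  have z_Q[measurable]: "z \<in> borel_measurable Q"
    using z_P by (simp add: measurable_cong_sets[OF sets refl])
  have sf: "sigma_finite_measure P" "sigma_finite_measure Q" "sigma_finite_measure N"
    "sigma_finite_measure M"
    by unfold_locales
  have "AE y in M. 0 < s y \<and> s y < \<top>"
    unfolding s_def by (rule AE_RN_deriv_pos_finite[OF sf(3,4) NM])
  then have s_pos: "AE x in Q. 0 < s (T x) \<and> s (T x) < \<top>"
    unfolding M_def by (subst (asm) AE_distr_iff) auto
  have z_pos: "AE x in Q. 0 < z x \<and> z x < \<top>"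
    unfolding z_def by (rule AE_RN_deriv_pos_finite[OF sf(1,2) ac sets])
  have W: "(\<integral>\<^sup>+x. s (T x) / z x \<partial>Q) \<le> 1"
  proof -
    have "(\<integral>\<^sup>+x. s (T x) / z x \<partial>Q) = (\<integral>\<^sup>+x. z x * (s (T x) / z x) \<partial>P)"
      unfolding z_def by (intro P.RN_deriv_nn_integral[OF ac sets]) measurable
    also have "\<dots> \<le> (\<integral>\<^sup>+x. s (T x) \<partial>P)"
    proof (rule nn_integral_mono_AE)
      show "AE x in P. z x * (s (T x) / z x) \<le> s (T x)"
        using P.RN_deriv_finite[OF sf(2) ac sets] unfolding z_def[symmetric]
      proof eventually_elim
        case (elim x)
        show ?case
        proof (cases "z x = 0")
          case False
          then have "z x * (s (T x) / z x) = s (T x)"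
            using elim by (simp add: ennreal_times_divide ennreal_divide_times mult.commute[of "z x"]
                mult_divide_eq_ennreal)
          then show ?thesis by simp
        qed auto
      qed
    qed
    also have "\<dots> = (\<integral>\<^sup>+y. s y \<partial>N)"
      unfolding N_def by (subst nn_integral_distr) auto
    also have "\<dots> = emeasure M (space M)"
      using N.RN_deriv_nn_integral[OF NM, of "\<lambda>_. 1"] unfolding s_def by simp
    finally show ?thesis
      by (simp add: M.emeasure_space_1)
  qed
  let ?h = "\<lambda>x. ln (enn2real (s (T x)))" and ?g = "\<lambda>x. ln (enn2real (z x))"
  have "(\<integral>\<^sup>+x. ennreal (?h x) + 1 + ennreal (- ?g x) \<partial>Q)
      \<le> (\<integral>\<^sup>+x. ennreal (?g x) + s (T x) / z x + ennreal (- ?h x) \<partial>Q)"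
  proof (rule nn_integral_mono_AE)
    show "AE x in Q. ennreal (?h x) + 1 + ennreal (- ?g x)
        \<le> ennreal (?g x) + s (T x) / z x + ennreal (- ?h x)"
      using s_pos z_pos
    proof eventually_elim
      case (elim x)
      then have "0 < enn2real (s (T x))" "0 < enn2real (z x)"
        by (auto simp: enn2real_positive_iff)
      from log_ratio_bound_ennreal[OF this] show ?case
        using elim by (simp add: ennreal_enn2real)
    qed
  qed
  then have sum: "(\<integral>\<^sup>+x. ennreal (?h x) \<partial>Q) + 1 + (\<integral>\<^sup>+x. ennreal (- ?g x) \<partial>Q)
      \<le> (\<integral>\<^sup>+x. ennreal (?g x) \<partial>Q) + (\<integral>\<^sup>+x. s (T x) / z x \<partial>Q) + (\<integral>\<^sup>+x. ennreal (- ?h x) \<partial>Q)"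
    by (simp add: nn_integral_add Q.emeasure_space_1)
  have push: "(\<integral>\<^sup>+y. ennreal (u (ln (enn2real (s y)))) \<partial>M) = (\<integral>\<^sup>+x. ennreal (u (?h x)) \<partial>Q)"
    if [measurable]: "u \<in> borel_measurable borel" for u :: "real \<Rightarrow> real"
    unfolding M_def by (subst nn_integral_distr) auto
  have "(\<integral>\<^sup>+x. ennreal (- ?h x) \<partial>Q) \<le> emeasure N (space N)"
    using nn_integral_neg_log_RN_deriv_le[OF sf(3,4) NM] push[of uminus]
    unfolding s_def[symmetric] by simp
  then have "(\<integral>\<^sup>+x. ennreal (- ?h x) \<partial>Q) < \<top>"
    by (rule le_less_trans) (simp add: less_top[symmetric] N.emeasure_finite)
  moreover have "(\<integral>\<^sup>+x. ennreal (- ?g x) \<partial>Q) < \<top>"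
    using nn_integral_neg_log_RN_deriv_le[OF sf(1,2) ac sets] unfolding z_def[symmetric]
    by (rule le_less_trans) (simp add: less_top[symmetric] P.emeasure_finite)
  ultimately have "enn2ereal (\<integral>\<^sup>+x. ennreal (?h x) \<partial>Q) - enn2ereal (\<integral>\<^sup>+x. ennreal (- ?h x) \<partial>Q)
      \<le> enn2ereal (\<integral>\<^sup>+x. ennreal (?g x) \<partial>Q) - enn2ereal (\<integral>\<^sup>+x. ennreal (- ?g x) \<partial>Q)"
    by (rule ereal_diff_le_of_cross_sum[OF sum W])
  then show ?thesis
    using push[of "\<lambda>x. x"] push[of uminus]
    by (simp add: signed_entropy_def ext_expectation_def s_def z_def M_def N_def)
qed

text \<open>The contraction above is an equality when \<open>dQ/dP\<close> is a function of \<open>T\<close>. For a prescribed law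
  \<open>\<mu>\<close> of \<open>T\<close> this leaves one candidate for \<open>dQ/dP\<close>, the density of \<open>\<mu>\<close> composed with \<open>T\<close>, and
  the push-forward formula for densities confirms that \<open>T\<close> then has the law \<open>\<mu>\<close>.\<close>

lemma
  assumes P: "finite_measure P" and \<mu>: "prob_space \<mu>"
    and T: "T \<in> P \<rightarrow>\<^sub>M S"
    and ac: "absolutely_continuous (distr P S T) \<mu>" and sets: "sets \<mu> = sets S"
  defines "Q \<equiv> density P (\<lambda>x. RN_deriv (distr P S T) \<mu> (T x))"
  shows distr_lift_marginal: "distr Q S T = \<mu>"
    and prob_space_lift_marginal: "prob_space Q"
    and absolutely_continuous_lift_marginal: "absolutely_continuous P Q"
    and entropy_lift_marginal: "signed_entropy P Q = signed_entropy (distr P S T) \<mu>"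
proof -
  interpret P: finite_measure P by fact
  interpret \<mu>: prob_space \<mu> by fact
  note [measurable] = T
  define N where "N = distr P S T"
  define s where "s = RN_deriv N \<mu>"
  interpret N: finite_measure N
    unfolding N_def by (rule P.finite_measure_distr[OF T])
  have s_S[measurable]: "s \<in> borel_measurable S"
    using borel_measurable_RN_deriv[of N \<mu>] unfolding s_def N_def by simp
  have N: "absolutely_continuous N \<mu>" "sets \<mu> = sets N"
    using ac sets by (auto simp: N_def)
  have Q: "Q = density P (\<lambda>x. s (T x))"
    by (simp add: Q_def s_def N_def)
  have "distr Q S T = density N s"
    unfolding Q N_def by (rule density_distr[symmetric]) measurable
  also have "\<dots> = \<mu>"
    unfolding s_def by (rule N.density_RN_deriv[OF N])
  finally show distr: "distr Q S T = \<mu>" .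
  have TQ[measurable]: "T \<in> Q \<rightarrow>\<^sub>M S"
    unfolding Q by simp
  show prob: "prob_space Q"
    by (rule prob_space_distrD[OF TQ]) (simp add: distr \<mu>)
  show "absolutely_continuous P Q"
    unfolding Q by (rule absolutely_continuousI_density) measurable
  then have "AE x in Q. s (T x) = RN_deriv P Q x"
    using P.RN_deriv_unique[of "\<lambda>x. s (T x)" Q] Q
    by (intro absolutely_continuous_AE[of Q P]) auto
  then have "signed_entropy P Q = ext_expectation Q (\<lambda>x. ereal (ln (enn2real (s (T x)))))"
    unfolding signed_entropy_def by (intro ext_expectation_cong_AE) auto
  also have "\<dots> = ext_expectation (distr Q S T) (\<lambda>y. ereal (ln (enn2real (s y))))"
    unfolding ext_expectation_def by (simp add: nn_integral_distr)
  finally show "signed_entropy P Q = signed_entropy (distr P S T) \<mu>"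
    by (simp add: distr signed_entropy_def s_def N_def)
qed

section \<open>The control cost as an entropy\<close>

definition gibbs_weight :: "ennreal \<Rightarrow> ennreal" where
  "gibbs_weight c = (if c = \<top> then 0 else ennreal (exp (- enn2real c)))"

lemma borel_measurable_gibbs_weight[measurable]: "gibbs_weight \<in> borel_measurable borel"
  unfolding gibbs_weight_def by measurable

lemma gibbs_weight_le_1: "gibbs_weight c \<le> 1"
  by (simp add: gibbs_weight_def)

lemma gibbs_weight_pos_iff: "0 < gibbs_weight c \<longleftrightarrow> c \<noteq> \<top>"
  by (simp add: gibbs_weight_def)

lemma finite_measure_density_gibbs_weight:
  assumes "finite_measure R" "F \<in> borel_measurable R"
  shows "finite_measure (density R (\<lambda>\<omega>. gibbs_weight (F \<omega>)))"
proof
  interpret finite_measure R by fact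
  note [measurable] = assms(2)
  have "emeasure (density R (\<lambda>\<omega>. gibbs_weight (F \<omega>))) (space R)
      = (\<integral>\<^sup>+\<omega>. gibbs_weight (F \<omega>) * indicator (space R) \<omega> \<partial>R)"
    by (rule emeasure_density) measurable
  also have "\<dots> \<le> (\<integral>\<^sup>+\<omega>. 1 \<partial>R)"
    by (intro nn_integral_mono) (auto simp: gibbs_weight_le_1 split: split_indicator)
  finally show "emeasure (density R (\<lambda>\<omega>. gibbs_weight (F \<omega>)))
      (space (density R (\<lambda>\<omega>. gibbs_weight (F \<omega>)))) \<noteq> \<infinity>"
    by (auto simp: top_unique)
qed

lemma absolutely_continuous_trans:
  "absolutely_continuous M N \<Longrightarrow> absolutely_continuous N K \<Longrightarrow> absolutely_continuous M K"
  by (auto simp: absolutely_continuous_def)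

lemma log_times_gibbs_weight:
  assumes "0 < z" "z < \<top>" "c \<noteq> \<top>"
  shows "enn2ereal c + ereal (ln (enn2real (z * gibbs_weight c))) = ereal (ln (enn2real z))"
proof -
  obtain r where r: "z = ennreal r" "0 < r"
    using assms(1,2) by (cases z) auto
  obtain k where k: "c = ennreal k" "0 \<le> k"
    using assms(3) by (cases c) auto
  have "enn2real (z * gibbs_weight c) = r * exp (- k)"
    using r k by (simp add: gibbs_weight_def ennreal_mult'[symmetric])
  then show ?thesis
    using r k by (simp add: ln_mult enn2ereal_ennreal)
qed

text \<open>If \<open>Q\<close> has no density with respect to \<open>R\<close>, or charges the set where the terminal cost \<open>F\<close> is
  infinite, both sides are infinite.
  Otherwise \<open>F = -log(exp(-F))\<close> merges with the logarithm of \<open>dQ/dR\<close>, by the chain rule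
  \<open>dQ/dR = (dQ/dP) exp(-F)\<close>. The measurable modification \<open>F\<close> of the terminal cost replaces the
  completed measures by the original ones.\<close>

lemma control_cost_eq_entropy:
  fixes R Q :: "(real \<Rightarrow> 'a::polish_space) measure"
  assumes R: "prob_space R" and Q: "prob_space Q" and sets: "sets Q = sets R"
    and F[measurable]: "F \<in> borel_measurable R" and F_eq: "AE \<omega> in R. f (X \<omega>) = F \<omega>"
  defines "P \<equiv> density R (\<lambda>\<omega>. gibbs_weight (F \<omega>))"
  shows "control_cost R X f Q = (if absolutely_continuous P Q then signed_entropy P Q else \<infinity>)"
proof -
  interpret R: prob_space R by fact
  interpret Q: prob_space Q by fact
  interpret P: finite_measure P
    unfolding P_def using F by (intro finite_measure_density_gibbs_weight) unfold_locales
  have sf: "sigma_finite_measure P" "sigma_finite_measure Q" "sigma_finite_measure R"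
    by unfold_locales
  have RP: "absolutely_continuous R P"
    unfolding P_def by (rule absolutely_continuousI_density) measurable
  have sets_P: "sets Q = sets P"
    using sets by (simp add: P_def)
  show ?thesis
  proof (cases "absolutely_continuous R Q")
    case False
    then have "\<not> absolutely_continuous P Q"
      using absolutely_continuous_trans[OF RP] by blast
    with False show ?thesis
      by (simp add: control_cost_def)
  next
    case RQ: True
    define y where "y = RN_deriv R Q"
    define g where "g \<omega> = enn2ereal (F \<omega>) + ereal (ln (enn2real (y \<omega>)))" for \<omega>
    have "AE \<omega> in Q. f (X \<omega>) = F \<omega>"
      by (rule absolutely_continuous_AE[OF sets RQ F_eq])
    then have "ext_expectation Q (\<lambda>\<omega>. enn2ereal (f (X \<omega>)) + ereal (ln (enn2real (y \<omega>))))
        = ext_expectation Q g"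
      by (intro ext_expectation_cong_AE) (auto simp: g_def)
    then have cost: "control_cost R X f Q = ext_expectation Q g"
      using RQ by (simp add: control_cost_def ext_expectation_def nn_integral_completion y_def)
    show ?thesis
    proof (cases "absolutely_continuous P Q")
      case PQ: True
      define z where "z = RN_deriv P Q"
      have z_P[measurable]: "z \<in> borel_measurable P"
        unfolding z_def by simp
      have z_R[measurable]: "z \<in> borel_measurable R"
        using z_P by (simp add: P_def)
      have "density R (\<lambda>\<omega>. gibbs_weight (F \<omega>) * z \<omega>) = density P z"
        unfolding P_def by (rule density_density_eq[symmetric]) measurable
      also have "\<dots> = Q"
        unfolding z_def by (rule P.density_RN_deriv[OF PQ sets_P])
      finally have "AE \<omega> in R. gibbs_weight (F \<omega>) * z \<omega> = y \<omega>"
        unfolding y_def by (intro R.RN_deriv_unique) measurable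
      then have y_eq: "AE \<omega> in Q. gibbs_weight (F \<omega>) * z \<omega> = y \<omega>"
        by (rule absolutely_continuous_AE[OF sets RQ])
      have "AE \<omega> in P. F \<omega> \<noteq> \<top>"
        unfolding P_def by (subst AE_density) (auto simp: gibbs_weight_pos_iff)
      then have F_fin: "AE \<omega> in Q. F \<omega> \<noteq> \<top>"
        by (rule absolutely_continuous_AE[OF sets_P PQ])
      have "AE \<omega> in Q. 0 < z \<omega> \<and> z \<omega> < \<top>"
        unfolding z_def by (rule AE_RN_deriv_pos_finite[OF sf(1,2) PQ sets_P])
      with y_eq F_fin have "AE \<omega> in Q. g \<omega> = ereal (ln (enn2real (z \<omega>)))"
      proof eventually_elim
        case (elim \<omega>)
        then show ?case
          using log_times_gibbs_weight[of "z \<omega>" "F \<omega>"] by (auto simp: g_def mult.commute)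
      qed
      then have "ext_expectation Q g = signed_entropy P Q"
        unfolding signed_entropy_def z_def[symmetric] by (rule ext_expectation_cong_AE)
      with cost PQ show ?thesis
        by simp
    next
      case False
      then obtain A where A: "A \<in> null_sets P" "A \<notin> null_sets Q"
        by (auto simp: absolutely_continuous_def)
      then have A_sets: "A \<in> sets Q" "A \<in> sets R"
        using sets sets_P by auto
      \<comment> \<open>The weight \<open>exp(-F)\<close> vanishes almost everywhere on a \<open>P\<close>-null set.\<close>
      have "AE \<omega> in R. \<omega> \<in> A \<longrightarrow> F \<omega> = \<top>"
        using A(1) unfolding P_def
        by (subst (asm) null_sets_density_iff) (auto simp: gibbs_weight_def split: if_splits
            elim!: eventually_mono)
      then have "AE \<omega> in Q. \<omega> \<in> A \<longrightarrow> F \<omega> = \<top>"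
        by (rule absolutely_continuous_AE[OF sets RQ])
      then have "(\<integral>\<^sup>+\<omega>. \<top> * indicator A \<omega> \<partial>Q) \<le> (\<integral>\<^sup>+\<omega>. e2ennreal (g \<omega>) \<partial>Q)"
        by (intro nn_integral_mono_AE)
          (auto elim!: eventually_mono simp: g_def split: split_indicator)
      moreover have "(\<integral>\<^sup>+\<omega>. \<top> * indicator A \<omega> \<partial>Q) = \<top>"
        using A(2) A_sets(1) by (subst nn_integral_cmult_indicator) (auto simp: ennreal_top_mult)
      ultimately have pos: "(\<integral>\<^sup>+\<omega>. e2ennreal (g \<omega>) \<partial>Q) = \<top>"
        by (simp add: top_unique)
      have "(\<integral>\<^sup>+\<omega>. e2ennreal (- g \<omega>) \<partial>Q) \<le> (\<integral>\<^sup>+\<omega>. ennreal (- ln (enn2real (y \<omega>))) \<partial>Q)"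
      proof (rule nn_integral_mono)
        fix \<omega>
        have "- g \<omega> \<le> ereal (- ln (enn2real (y \<omega>)))"
          by (cases "F \<omega>") (auto simp: g_def enn2ereal_ennreal)
        then show "e2ennreal (- g \<omega>) \<le> ennreal (- ln (enn2real (y \<omega>)))"
          using e2ennreal_mono by fastforce
      qed
      also have "\<dots> \<le> emeasure R (space R)"
        unfolding y_def by (rule nn_integral_neg_log_RN_deriv_le[OF sf(3,2) RQ sets])
      finally have "(\<integral>\<^sup>+\<omega>. e2ennreal (- g \<omega>) \<partial>Q) \<le> 1"
        by (simp add: R.emeasure_space_1)
      then obtain r where "(\<integral>\<^sup>+\<omega>. e2ennreal (- g \<omega>) \<partial>Q) = ennreal r" "0 \<le> r"
        by (cases "\<integral>\<^sup>+\<omega>. e2ennreal (- g \<omega>) \<partial>Q") (auto simp: top_unique)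
      with pos have "ext_expectation Q g = \<infinity>"
        by (simp add: ext_expectation_def enn2ereal_ennreal)
      with cost False show ?thesis
        by simp
    qed
  qed
qed

section \<open>Measurability of the state at a random time\<close>

lemma space_coord_sigma[simp]: "space (coord_sigma T) = cadlag_paths"
  unfolding coord_sigma_def by (rule space_measure_of) auto

lemma sets_coord_sigma:
  "sets (coord_sigma T)
    = sigma_sets cadlag_paths {{\<omega> \<in> cadlag_paths. \<omega> s \<in> A} | s A. s \<in> T \<and> A \<in> sets borel}"
  unfolding coord_sigma_def by (rule sets_measure_of) auto

lemma sets_coord_sigma_mono: "S \<subseteq> T \<Longrightarrow> sets (coord_sigma S) \<subseteq> sets (coord_sigma T)"
  unfolding sets_coord_sigma by (rule sigma_sets_mono') auto

lemma measurable_coordinate: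
  "s \<in> T \<Longrightarrow> (\<lambda>\<omega>. \<omega> s) \<in> coord_sigma T \<rightarrow>\<^sub>M borel"
proof (rule measurableI)
  fix A :: "'a set" assume "s \<in> T" "A \<in> sets borel"
  then have "{\<omega> \<in> cadlag_paths. \<omega> s \<in> A} \<in> sets (coord_sigma T)"
    unfolding sets_coord_sigma by (intro sigma_sets.Basic) auto
  also have "{\<omega> \<in> cadlag_paths. \<omega> s \<in> A} = (\<lambda>\<omega>. \<omega> s) -` A \<inter> space (coord_sigma T)"
    by auto
  finally show "(\<lambda>\<omega>. \<omega> s) -` A \<inter> space (coord_sigma T) \<in> sets (coord_sigma T)" .
qed simp

lemma space_path_space[simp]: "space path_space = cadlag_paths"
  by (simp add: path_space_def)

text \<open>This places a stopping time of the augmented filtration among the random variables of the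
  completed space.\<close>

lemma aug_filtration_subset_completion:
  assumes sets: "sets R = sets path_space"
  shows "sets (aug_filtration R t) \<subseteq> sets (completion R)"
    and "space (aug_filtration R t) = space R"
proof -
  have space: "space R = cadlag_paths"
    using sets_eq_imp_space_eq[OF sets] by simp
  have right: "sets (right_filtration u) \<subseteq> sets R" if "0 \<le> u" for u
  proof -
    have sub: "(\<Inter>v\<in>{u<..}. sets (coord_sigma {0..v})) \<subseteq> sets path_space"
      unfolding path_space_def
      using sets_coord_sigma_mono[of "{0..u+1}" "{0..}"] by (auto dest!: bspec[of _ _ "u + 1"])
    then have "(\<Inter>v\<in>{u<..}. sets (coord_sigma {0..v})) \<subseteq> Pow cadlag_paths"
      using sets.sets_into_space[of _ path_space] by auto
    then have "sets (right_filtration u)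
        = sigma_sets cadlag_paths (\<Inter>v\<in>{u<..}. sets (coord_sigma {0..v}))"
      unfolding right_filtration_def by (rule sets_measure_of)
    also have "\<dots> \<subseteq> sets R"
      using sets.sigma_sets_subset[of _ R] sub sets space by auto
    finally show ?thesis .
  qed
  let ?G = "sets (right_filtration (enn2real t)) \<union> null_sets (completion R)"
  have sub: "?G \<subseteq> sets (completion R)"
    using right[of "enn2real t"] by auto
  then have Pow: "?G \<subseteq> Pow cadlag_paths"
    using sets.sets_into_space[of _ "completion R"] space by auto
  show "sets (aug_filtration R t) \<subseteq> sets (completion R)"
    using sets.sigma_sets_subset[OF sub] space Pow
    by (auto simp: aug_filtration_def sets_measure_of)
  show "space (aug_filtration R t) = space R"
    using space Pow by (simp add: aug_filtration_def space_measure_of)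
qed

text \<open>A right-continuous process is measurable at a random time \<open>T\<close> because it is the limit of the
  same process at the times \<open>(\<lfloor>(n + 1) T\<rfloor> + 1) / (n + 1)\<close>, which have countably many values and
  converge to \<open>T\<close> from above. They are strictly greater than \<open>T\<close>, as the limit along \<open>at_right\<close> needs.\<close>

lemma measurable_cadlag_at_random_time:
  fixes R :: "(real \<Rightarrow> 'a::polish_space) measure" and T :: "(real \<Rightarrow> 'a) \<Rightarrow> real"
  assumes sets: "sets R = sets path_space"
    and T[measurable]: "T \<in> borel_measurable (completion R)" and nonneg: "\<And>\<omega>. 0 \<le> T \<omega>"
  shows "(\<lambda>\<omega>. \<omega> (T \<omega>)) \<in> completion R \<rightarrow>\<^sub>M borel"
proof (rule borel_measurable_LIMSEQ_metric)
  let ?k = "\<lambda>n \<omega>. nat \<lfloor>real (Suc n) * T \<omega>\<rfloor>"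
  let ?T = "\<lambda>n \<omega>. real (Suc (?k n \<omega>)) / real (Suc n)"
  show "(\<lambda>\<omega>. \<omega> (?T n \<omega>)) \<in> completion R \<rightarrow>\<^sub>M borel" for n
  proof (rule measurable_compose_countable
      [where f = "\<lambda>k \<omega>. \<omega> (real (Suc k) / real (Suc n))" and g = "?k n"])
    fix k :: nat
    have "(\<lambda>\<omega>. \<omega> (real (Suc k) / real (Suc n))) \<in> R \<rightarrow>\<^sub>M (borel :: 'a measure)"
      unfolding measurable_cong_sets[OF sets refl] path_space_def
      by (rule measurable_coordinate) simp
    then show "(\<lambda>\<omega>. \<omega> (real (Suc k) / real (Suc n))) \<in> completion R \<rightarrow>\<^sub>M (borel :: 'a measure)"
      by (rule measurable_completion)
  qed measurable
  fix \<omega> assume "\<omega> \<in> space (completion R)"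
  then have "\<omega> \<in> cadlag_paths"
    using sets_eq_imp_space_eq[OF sets] by simp
  then have right: "(\<omega> \<longlongrightarrow> \<omega> (T \<omega>)) (at_right (T \<omega>))"
    using nonneg by (auto simp: cadlag_paths_def)
  have bounds: "T \<omega> < ?T n \<omega>" "?T n \<omega> \<le> T \<omega> + 1 / real (Suc n)" for n
  proof -
    define N where "N = real (Suc n)"
    have N_pos: "0 < N"
      by (simp add: N_def)
    define K where "K = real (?k n \<omega>)"
    have "K = of_int \<lfloor>N * T \<omega>\<rfloor>"
      using nonneg[of \<omega>] by (simp add: K_def N_def)
    then have "N * T \<omega> < K + 1" "K \<le> N * T \<omega>"
      by linarith+
    then have "T \<omega> < (K + 1) / N" "(K + 1) / N \<le> T \<omega> + 1 / N"
      using N_pos by (simp_all add: field_simps)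
    then show "T \<omega> < ?T n \<omega>" "?T n \<omega> \<le> T \<omega> + 1 / real (Suc n)"
      by (simp_all add: K_def N_def add.commute)
  qed
  have "(\<lambda>n. T \<omega> + 1 / real (Suc n)) \<longlonglongrightarrow> T \<omega> + 0"
    by (intro tendsto_intros LIMSEQ_Suc lim_1_over_n)
  then have "(\<lambda>n. ?T n \<omega>) \<longlonglongrightarrow> T \<omega>"
    using bounds(2) less_imp_le[OF bounds(1)]
    by (intro tendsto_sandwich[of "\<lambda>_. T \<omega>" "\<lambda>n. ?T n \<omega>" sequentially
          "\<lambda>n. T \<omega> + 1 / real (Suc n)"] always_eventually allI tendsto_const)
      (simp_all only: add_0_right)
  then have "filterlim (\<lambda>n. ?T n \<omega>) (at_right (T \<omega>)) sequentially"
    using bounds(1) less_imp_neq[OF bounds(1), THEN not_sym]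
    unfolding filterlim_at by (intro conjI always_eventually allI) (simp_all only: greaterThan_iff simp_thms)
  with right show "(\<lambda>n. \<omega> (?T n \<omega>)) \<longlonglongrightarrow> \<omega> (T \<omega>)"
    by (rule filterlim_compose)
qed

lemma measurable_state_at:
  fixes R :: "(real \<Rightarrow> 'a::polish_space) measure"
  assumes sets: "sets R = sets path_space" and \<tau>: "stopping_time (aug_filtration R) \<tau>"
    and \<xi>[measurable]: "\<xi> \<in> completion R \<rightarrow>\<^sub>M borel"
  shows "state_at \<tau> \<xi> \<in> completion R \<rightarrow>\<^sub>M borel"
proof -
  have [measurable]: "\<tau> \<in> borel_measurable (completion R)"
    using aug_filtration_subset_completion[OF sets] by (intro measurable_stopping_time[OF \<tau>]) auto
  have [measurable]: "(\<lambda>\<omega>. \<omega> (enn2real (\<tau> \<omega>))) \<in> completion R \<rightarrow>\<^sub>M borel"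
    by (rule measurable_cadlag_at_random_time[OF sets]) auto
  show ?thesis
    unfolding state_at_def[abs_def] by measurable
qed

section \<open>Existence of a minimiser\<close>

lemma absolutely_continuous_of_rel_entropy_finite:
  "rel_entropy \<alpha> \<beta> < \<top> \<Longrightarrow> absolutely_continuous \<beta> \<alpha>"
  by (auto simp: rel_entropy_def split: if_splits)

lemma admissible_lift:
  fixes P :: "(real \<Rightarrow> 'a::polish_space) measure"
  assumes P: "finite_measure P" and sets: "sets P = sets path_space"
    and \<mu>: "prob_space \<mu>" "sets \<mu> = sets borel"
    and ac: "absolutely_continuous (marginal P 0) \<mu>"
  shows "density P (\<lambda>\<omega>. RN_deriv (marginal P 0) \<mu> (\<omega> 0)) \<in> admissible \<mu>"
proof -
  have T: "(\<lambda>\<omega>. \<omega> 0) \<in> P \<rightarrow>\<^sub>M borel"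
    unfolding measurable_cong_sets[OF sets refl] path_space_def
    by (rule measurable_coordinate) simp
  note lift = P \<mu>(1) T ac[unfolded marginal_def] \<mu>(2)
  show ?thesis
    using distr_lift_marginal[OF lift] prob_space_lift_marginal[OF lift] sets
    by (simp add: admissible_def path_measure_def marginal_def)
qed

theorem theorem1p1:
  fixes L :: "'a::polish_space \<Rightarrow> 'a measure"
    and R :: "(real \<Rightarrow> 'a) measure"
    and \<tau> :: "(real \<Rightarrow> 'a) \<Rightarrow> ennreal"
    and \<xi> :: "(real \<Rightarrow> 'a) \<Rightarrow> 'a"
    and X\<tau> :: "(real \<Rightarrow> 'a) \<Rightarrow> 'a"
    and f :: "'a \<Rightarrow> ennreal"
    and D :: "'a set"
    and \<mu> :: "'a measure"
  defines "X\<tau> \<equiv> state_at \<tau> \<xi>"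
  assumes "bounded_rate L"
    and "jump_law L R"
    and "positive_jump_process L"
    and "stopping_time (aug_filtration R) \<tau>"
    and "\<xi> \<in> completion R \<rightarrow>\<^sub>M borel"
    and "\<exists>x. f x \<noteq> \<top>"
    and "(\<lambda>\<omega>. f (X\<tau> \<omega>)) \<in> borel_measurable (vimage_algebra (space R) X\<tau> borel)"
    and "{\<omega> \<in> space R. X\<tau> \<omega> \<in> D} \<in> sets (vimage_algebra (space R) X\<tau> borel)"
    and "D \<subseteq> {x. f x < \<top>}"
    and "emeasure (image_law (completion R) X\<tau>) D > 0"
    and "(\<integral>\<^sup>+x\<in>D. f x \<partial>image_law (completion R) X\<tau>) < \<top>"
    and "prob_space \<mu>" and "sets \<mu> = sets borel"
    and "rel_entropy \<mu> (marginal R 0) < \<top>"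
  shows "\<exists>Q\<in>admissible \<mu>. control_cost R X\<tau> f Q = gamma_sto R X\<tau> f \<mu>"
proof -
  have R: "prob_space R" and sets: "sets R = sets path_space"
    using assms(3) by (auto simp: jump_law_def path_measure_def)
  interpret R: prob_space R by fact
  have "X\<tau> \<in> completion R \<rightarrow>\<^sub>M borel"
    unfolding X\<tau>_def by (rule measurable_state_at[OF sets assms(5,6)])
  then have "sets (vimage_algebra (space R) X\<tau> borel) \<subseteq> sets (completion R)"
    by (auto simp: sets_vimage_algebra2 dest: measurable_sets)
  with assms(8) have "(\<lambda>\<omega>. f (X\<tau> \<omega>)) \<in> borel_measurable (completion R)"
    by (auto simp: measurable_def)
  then obtain F where F: "F \<in> borel_measurable R" and F_eq: "AE \<omega> in R. f (X\<tau> \<omega>) = F \<omega>"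
    using completion_ex_borel_measurable by blast
  define P where "P = density R (\<lambda>\<omega>. gibbs_weight (F \<omega>))"
  have P: "finite_measure P" and sets_P: "sets P = sets path_space"
    using F sets by (auto simp: P_def intro!: finite_measure_density_gibbs_weight) unfold_locales
  have T: "(\<lambda>\<omega>. \<omega> 0) \<in> P \<rightarrow>\<^sub>M borel"
    unfolding measurable_cong_sets[OF sets_P refl] path_space_def
    by (rule measurable_coordinate) simp
  have cost: "control_cost R X\<tau> f Q = (if absolutely_continuous P Q then signed_entropy P Q else \<infinity>)"
    if "Q \<in> admissible \<mu>" for Q
    using that sets unfolding P_def
    by (intro control_cost_eq_entropy[OF R _ _ F F_eq]) (auto simp: admissible_def path_measure_def)
  have "\<exists>Q\<in>admissible \<mu>. \<forall>Q'\<in>admissible \<mu>. control_cost R X\<tau> f Q \<le> control_cost R X\<tau> f Q'"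
  proof (cases "absolutely_continuous (marginal P 0) \<mu>")
    case ac: True
    \<comment> \<open>Its \<open>P\<close>-density depends on the initial state only, so the entropy contraction is an
      equality.\<close>
    let ?Q = "density P (\<lambda>\<omega>. RN_deriv (marginal P 0) \<mu> (\<omega> 0))"
    have adm: "?Q \<in> admissible \<mu>"
      by (rule admissible_lift[OF P sets_P assms(13,14) ac])
    note lift = P assms(13) T ac[unfolded marginal_def] assms(14)
    have opt: "control_cost R X\<tau> f ?Q = signed_entropy (marginal P 0) \<mu>"
      unfolding cost[OF adm]
      using absolutely_continuous_lift_marginal[OF lift] entropy_lift_marginal[OF lift]
      by (simp add: marginal_def)
    have "signed_entropy (marginal P 0) \<mu> \<le> control_cost R X\<tau> f Q" if Q: "Q \<in> admissible \<mu>" for Q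
      unfolding cost[OF Q]
      using Q entropy_push_forward_le[OF P _ _ _ T, of Q] sets_P
      by (auto simp: admissible_def path_measure_def marginal_def)
    with adm show ?thesis
      by (intro bexI[of _ ?Q]) (auto simp only: opt)
  next
    case False
    \<comment> \<open>An admissible \<open>Q\<close> that is absolutely continuous with respect to \<open>P\<close> would pass this property
      on to the initial laws.\<close>
    have "control_cost R X\<tau> f Q = \<infinity>" if Q: "Q \<in> admissible \<mu>" for Q
    proof -
      have "\<not> absolutely_continuous P Q"
        using False Q absolutely_continuous_distr[OF _ _ T, of Q] sets_P
        by (auto simp: admissible_def path_measure_def marginal_def)
      then show ?thesis
        by (simp add: cost[OF Q])
    qed
    moreover have "density R (\<lambda>\<omega>. RN_deriv (marginal R 0) \<mu> (\<omega> 0)) \<in> admissible \<mu>"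
      by (intro admissible_lift sets assms(13,14) R.finite_measure_axioms
          absolutely_continuous_of_rel_entropy_finite assms(15))
    ultimately show ?thesis
      by fastforce
  qed
  then obtain Q where Q: "Q \<in> admissible \<mu>"
    and le: "\<And>Q'. Q' \<in> admissible \<mu> \<Longrightarrow> control_cost R X\<tau> f Q \<le> control_cost R X\<tau> f Q'"
    by blast
  have "control_cost R X\<tau> f Q = gamma_sto R X\<tau> f \<mu>"
    unfolding gamma_sto_def using Q le by (intro antisym INF_greatest INF_lower)
  with Q show ?thesis
    by blast
qed

end
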